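(* Let $(V,\omega)$ be a VOA of CFT type over $\mathbb{K}$. The map $J_1(V)\to\mathrm{Aut}^{-}V$, $a\mapsto\exp(a(1))$, is an isomorphism of groups, where $J_1(V)$ is considered as an additive group.
   Context: The base field $\mathbb{K}$ is $\mathbb{R}$ or $\mathbb{C}$. For a vertex algebra $V$ over $\mathbb{K}$ with vacuum vector $\mathbf{1}$, $a(n)b$ denotes the $n$-th product ($n\in\mathbb{Z}$), $a(n)\in\mathrm{End}\,V$, and $Ta=a(-2)\mathbf{1}$. A $\mathbb{Z}$-graded vertex algebra is a vertex algebra $V=\bigoplus_{n\in\mathbb{Z}}V_n$ with $V_n(k)V_m\subset V_{n+m-k-1}$ and $\mathbf{1}\in V_0$. A $\mathbb{Z}$-graded conformal vertex algebra $(V,\omega)$ is a $\mathbb{Z}$-graded vertex algebra with a distinguished $\omega\in V_2$ such that the operators $L(n)=\omega(n+1)$ satisfy $[L(n),L(m)]=(n-m)L(n+m)+\frac{1}{12}\delta_{n+m,0}(n^3-n)c$ for some $c\in\mathbb{K}$, $L(0)v=nv$ for $v\in V_n$, and $L(-1)=T$. It is a VOA of CFT type if $V=\bigoplus_{n\in\mathbb{N}}V_n$ (with $\mathbb{N}=\{0,1,2,\dots\}$), $\dim V_n<\infty$ for all $n$, and $V_0=\mathbb{K}\mathbf{1}$. $J_1(V)=\{a\in V_1\mid a(0)=0\}$; for $a\in J_1(V)$ the operator $a(1)$ is a locally nilpotent derivation, so $\exp(a(1))$ is well defined. $\mathrm{Aut}\,V$ is the group of vertex algebra automorphisms (linear isomorphisms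 $f$ with $f(a(n)b)=f(a)(n)f(b)$ and $f(\mathbf{1})=\mathbf{1}$); with $\mathrm{pr}_n:V\to V_n$ the canonical projection, $\mathrm{Aut}^{-}V=\{f\in\mathrm{Aut}\,V\mid f(V_n)\subset\bigoplus_{k\le n}V_k\text{ and }\mathrm{pr}_n\circ f|_{V_n}=\mathrm{id}_{V_n}\text{ for all }n\}$. *)

theory Defs
  imports Complex_Main "HOL-Library.Groups_Big_Fun" "HOL-Algebra.Group"
begin

text \<open>
  The vector space is a whole type with an explicit scalar multiplication. The \<open>n\<close>-th product
  \<open>a(n)b\<close> is \<open>nprod a n b\<close>, so \<open>nprod a n\<close> is the operator \<open>a(n)\<close>. Infinite sums with finitely
  many nonzero terms are written with \<^const>\<open>Sum_any\<close>, which is \<open>0\<close> on an infinite support. In the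
  Borcherds identity both supports are finite by truncation and bilinearity.
\<close>

locale vertex_algebra = vector_space scale
  for scale :: "'k::field_char_0 \<Rightarrow> 'v::ab_group_add \<Rightarrow> 'v" (infixr \<open>*s\<close> 75) +
  fixes nprod :: "'v \<Rightarrow> int \<Rightarrow> 'v \<Rightarrow> 'v"
    and vac :: 'v
  assumes linear_left: "Vector_Spaces.linear scale scale (\<lambda>a. nprod a n b)"
    and linear_right: "Vector_Spaces.linear scale scale (nprod a n)"
    and truncation: "\<exists>N. \<forall>n\<ge>N. nprod a n b = 0"
    and vacuum_left: "nprod vac n a = (if n = -1 then a else 0)"
    and vacuum_right: "n \<ge> 0 \<Longrightarrow> nprod a n vac = 0"
    and creation: "nprod a (-1) vac = a"
    and borcherds:
      "Sum_any (\<lambda>i::nat. (of_int p gchoose i) *s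
           nprod (nprod a (r + int i) b) (p + q - int i) c) =
       Sum_any (\<lambda>i::nat. ((-1) ^ i * (of_int r gchoose i)) *s
           (nprod a (p + r - int i) (nprod b (q + int i) c)
            - ((-1) powi r) *s nprod b (q + r - int i) (nprod a (p + int i) c)))"

definition is_decomp :: "(int \<Rightarrow> 'v::comm_monoid_add set) \<Rightarrow> 'v \<Rightarrow> (int \<Rightarrow> 'v) \<Rightarrow> bool" where
  "is_decomp G v f \<longleftrightarrow> finite {n. f n \<noteq> 0} \<and> (\<forall>n. f n \<in> G n) \<and> v = Sum_any f"

text \<open>The canonical projection, meaningful when the homogeneous decomposition is unique.\<close>

definition pr :: "(int \<Rightarrow> 'v::comm_monoid_add set) \<Rightarrow> int \<Rightarrow> 'v \<Rightarrow> 'v" where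
  "pr G n v = (THE f. is_decomp G v f) n"

locale graded_vertex_algebra = vertex_algebra scale nprod vac
  for scale :: "'k::field_char_0 \<Rightarrow> 'v::ab_group_add \<Rightarrow> 'v" (infixr \<open>*s\<close> 75)
    and nprod :: "'v \<Rightarrow> int \<Rightarrow> 'v \<Rightarrow> 'v"
    and vac :: 'v +
  fixes G :: "int \<Rightarrow> 'v set"
  assumes subspace_G: "subspace (G n)"
    and direct_sum: "\<exists>!f. is_decomp G v f"
    and nprod_degree: "a \<in> G n \<Longrightarrow> b \<in> G m \<Longrightarrow> nprod a k b \<in> G (n + m - k - 1)"
    and vac_degree: "vac \<in> G 0"

text \<open>\<open>nprod \<omega> (n + 1)\<close> is the Virasoro operator \<open>L(n)\<close>. In particular \<open>nprod \<omega> 1\<close> is \<open>L(0)\<close> and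
  \<open>nprod \<omega> 0\<close> is \<open>L(-1)\<close>.\<close>

locale conformal_vertex_algebra = graded_vertex_algebra scale nprod vac G
  for scale :: "'k::field_char_0 \<Rightarrow> 'v::ab_group_add \<Rightarrow> 'v" (infixr \<open>*s\<close> 75)
    and nprod :: "'v \<Rightarrow> int \<Rightarrow> 'v \<Rightarrow> 'v"
    and vac :: 'v
    and G :: "int \<Rightarrow> 'v set" +
  fixes \<omega> :: 'v
  assumes omega_degree: "\<omega> \<in> G 2"
    and virasoro: "\<exists>c::'k. \<forall>n m v.
      nprod \<omega> (n + 1) (nprod \<omega> (m + 1) v) - nprod \<omega> (m + 1) (nprod \<omega> (n + 1) v) =
      of_int (n - m) *s nprod \<omega> (n + m + 1) v
      + (if n + m = 0 then (1 / 12 * of_int (n ^ 3 - n) * c) *s v else 0)"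
    and L0_degree: "v \<in> G n \<Longrightarrow> nprod \<omega> 1 v = of_int n *s v"
    and L_minus_1: "nprod \<omega> 0 v = nprod v (-2) vac"

locale cft_type_voa = conformal_vertex_algebra scale nprod vac G \<omega>
  for scale :: "'k::field_char_0 \<Rightarrow> 'v::ab_group_add \<Rightarrow> 'v" (infixr \<open>*s\<close> 75)
    and nprod :: "'v \<Rightarrow> int \<Rightarrow> 'v \<Rightarrow> 'v"
    and vac :: 'v
    and G :: "int \<Rightarrow> 'v set"
    and \<omega> :: 'v +
  assumes nonneg_degree: "n < 0 \<Longrightarrow> G n = {0}"
    and finite_dim: "\<exists>B. finite B \<and> G n = span B"
    and G_0: "G 0 = span {vac}"

definition J1 :: "('v::ab_group_add \<Rightarrow> int \<Rightarrow> 'v \<Rightarrow> 'v) \<Rightarrow> (int \<Rightarrow> 'v set) \<Rightarrow> 'v set" where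
  "J1 nprod G = {a \<in> G 1. \<forall>v. nprod a 0 v = 0}"

definition J1_group :: "('v::ab_group_add \<Rightarrow> int \<Rightarrow> 'v \<Rightarrow> 'v) \<Rightarrow> (int \<Rightarrow> 'v set) \<Rightarrow> 'v monoid" where
  "J1_group nprod G = \<lparr>carrier = J1 nprod G, monoid.mult = (+), one = 0\<rparr>"

text \<open>The exponential of a locally nilpotent operator. In a vertex operator algebra of CFT type,
  \<open>a(1)\<close> with \<open>a\<close> of degree \<open>1\<close> lowers degrees by \<open>1\<close>, so the sum has finite support.\<close>

definition exp_op :: "('k::field_char_0 \<Rightarrow> 'v::ab_group_add \<Rightarrow> 'v) \<Rightarrow> ('v \<Rightarrow> 'v) \<Rightarrow> 'v \<Rightarrow> 'v" where
  "exp_op scale f v = Sum_any (\<lambda>k::nat. scale (1 / fact k) ((f ^^ k) v))"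

definition va_aut :: "('k::field_char_0 \<Rightarrow> 'v::ab_group_add \<Rightarrow> 'v) \<Rightarrow>
    ('v \<Rightarrow> int \<Rightarrow> 'v \<Rightarrow> 'v) \<Rightarrow> 'v \<Rightarrow> ('v \<Rightarrow> 'v) set" where
  "va_aut scale nprod vac = {f. Vector_Spaces.linear scale scale f \<and> bij f \<and>
     (\<forall>a n b. f (nprod a n b) = nprod (f a) n (f b)) \<and> f vac = vac}"

definition va_aut_group :: "('k::field_char_0 \<Rightarrow> 'v::ab_group_add \<Rightarrow> 'v) \<Rightarrow>
    ('v \<Rightarrow> int \<Rightarrow> 'v \<Rightarrow> 'v) \<Rightarrow> 'v \<Rightarrow> ('v \<Rightarrow> 'v) monoid" where
  "va_aut_group scale nprod vac =
     \<lparr>carrier = va_aut scale nprod vac, monoid.mult = (\<circ>), one = id\<rparr>"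

definition va_aut_minus :: "('k::field_char_0 \<Rightarrow> 'v::ab_group_add \<Rightarrow> 'v) \<Rightarrow>
    ('v \<Rightarrow> int \<Rightarrow> 'v \<Rightarrow> 'v) \<Rightarrow> 'v \<Rightarrow> (int \<Rightarrow> 'v set) \<Rightarrow> ('v \<Rightarrow> 'v) set" where
  "va_aut_minus scale nprod vac G = {f \<in> va_aut scale nprod vac. \<forall>n.
     f ` G n \<subseteq> module.span scale (\<Union>k\<in>{..n}. G k) \<and> (\<forall>v\<in>G n. pr G n (f v) = v)}"

definition va_aut_minus_group :: "('k::field_char_0 \<Rightarrow> 'v::ab_group_add \<Rightarrow> 'v) \<Rightarrow>
    ('v \<Rightarrow> int \<Rightarrow> 'v \<Rightarrow> 'v) \<Rightarrow> 'v \<Rightarrow> (int \<Rightarrow> 'v set) \<Rightarrow> ('v \<Rightarrow> 'v) monoid" where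
  "va_aut_minus_group scale nprod vac G =
     (va_aut_group scale nprod vac)\<lparr>carrier := va_aut_minus scale nprod vac G\<rparr>"

text \<open>
  The base field \<open>\<real>\<close> or \<open>\<complex>\<close> is rendered by a type of class \<^class>\<open>real_normed_field\<close>. Both are
  instances, and by the Gelfand--Mazur theorem every instance is isomorphic to one of them.
\<close>

end

theory Submission
  imports Defs
begin

text \<open>
  The proof rests on one rigidity statement. Write \<open>F n\<close> for the sum of the \<open>G k\<close> with
  \<open>k \<le> n\<close>, and call an endomorphism \<open>f\<close> of the vertex algebra unipotent if
  \<open>f v - v \<in> F (n - 1)\<close> for \<open>v \<in> G n\<close>. Then \<open>f\<close> is determined by the component of \<open>f \<omega>\<close> in
  \<open>G 1\<close> (\<open>unip_end_eqI\<close>). Indeed \<open>f \<omega> = \<omega> + a + c vac\<close> with \<open>a \<in> G 1\<close>, so applying \<open>f\<close> to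
  \<open>L(0) v = n v\<close> gives \<open>(L(0) + a(1)) (f v) = n (f v)\<close> for \<open>v \<in> G n\<close>. Two unipotent
  endomorphisms with the same \<open>a\<close> differ on \<open>v\<close> by some \<open>u \<in> F (n - 1)\<close> satisfying the same
  equation. Since \<open>a(1)\<close> lowers the filtration and \<open>L(0) - n\<close> is invertible on \<open>G m\<close> for
  \<open>m < n\<close>, the top component of \<open>u\<close> vanishes, and by descent \<open>u = 0\<close>.

  For \<open>a \<in> J1\<close> the operator \<open>a(1)\<close> is a derivation lowering the degree by one, hence locally
  nilpotent, so \<open>exp (a(1))\<close> is a unipotent endomorphism. The identity \<open>a(1) \<omega> = a\<close>
  (\<open>nprod_1_omega\<close>) shows that its invariant is \<open>a\<close>. All remaining claims now follow by comparing
  invariants, which add up under composition: \<open>exp\<close> is injective and a homomorphism,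
  \<open>exp (-a(1))\<close> inverts \<open>exp (a(1))\<close>, and an automorphism \<open>f\<close> with invariant \<open>a\<close>
  equals \<open>exp (a(1))\<close> as soon as \<open>a \<in> J1\<close>. The last condition holds since \<open>f\<close> commutes with
  \<open>T = \<omega>(0)\<close>: conjugating \<open>\<omega>(0)\<close> by \<open>f\<close> yields \<open>\<omega>(0) + a(0)\<close>, so \<open>a(0) = 0\<close>.
\<close>

section \<open>Exponentials of locally nilpotent derivations\<close>

lemma Sum_any_eq_sum_lessThan:
  fixes g :: "nat \<Rightarrow> 'a::comm_monoid_add"
  assumes "\<And>i. i \<ge> N \<Longrightarrow> g i = 0"
  shows "Sum_any g = (\<Sum>i<N. g i)"
  by (rule Sum_any.expand_superset) (use assms in \<open>auto simp: not_le[symmetric]\<close>)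

lemma sum_triangle_eq_square:
  fixes g :: "nat \<Rightarrow> nat \<Rightarrow> 'a::comm_monoid_add"
  assumes "\<And>i j. i + j \<ge> N \<Longrightarrow> g i j = 0"
  shows "(\<Sum>k<N. \<Sum>i\<le>k. g i (k - i)) = (\<Sum>i<N. \<Sum>j<N. g i j)"
proof -
  have "(\<Sum>i<N. \<Sum>j<N. g i j) = (\<Sum>(i,j)\<in>{..<N} \<times> {..<N}. g i j)"
    by (simp add: sum.cartesian_product)
  also have "\<dots> = (\<Sum>(i,j)\<in>{(i,j). i + j < N}. g i j)"
    by (rule sum.mono_neutral_right) (use assms in \<open>auto simp: not_less[symmetric]\<close>)
  finally show ?thesis
    by (simp add: sum.triangle_reindex)
qed

context vertex_algebra
begin

lemma nprod_add_left: "nprod (a + b) n c = nprod a n c + nprod b n c"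
  and nprod_scale_left: "nprod (r *s a) n c = r *s nprod a n c"
  using linear_left[of n c] by (auto simp: Vector_Spaces.linear_iff)

lemma nprod_add_right: "nprod c n (a + b) = nprod c n a + nprod c n b"
  and nprod_scale_right: "nprod c n (r *s a) = r *s nprod c n a"
  using linear_right[of c n] by (auto simp: Vector_Spaces.linear_iff)

lemma nprod_zero_left [simp]: "nprod 0 n c = 0"
  using nprod_scale_left[of 0 0 n c] by simp

lemma nprod_zero_right [simp]: "nprod c n 0 = 0"
  using nprod_scale_right[of c n 0 0] by simp

lemma nprod_diff_right: "nprod c n (a - b) = nprod c n a - nprod c n b"
  using nprod_add_right[of c n "a - b" b] by (simp add: algebra_simps)

lemma nprod_sum_left: "nprod (\<Sum>i\<in>I. g i) n c = (\<Sum>i\<in>I. nprod (g i) n c)"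
  by (induction I rule: infinite_finite_induct) (auto simp: nprod_add_left)

lemma nprod_sum_right: "nprod c n (\<Sum>i\<in>I. g i) = (\<Sum>i\<in>I. nprod c n (g i))"
  by (induction I rule: infinite_finite_induct) (auto simp: nprod_add_right)

text \<open>The Borcherds identity with \<open>r = 0\<close> and \<open>p = 1\<close>, where only \<open>a(0)\<close> and \<open>a(1)\<close> enter.\<close>

lemma nprod_1_derivation:
  assumes "\<And>v. nprod a 0 v = 0"
  shows "nprod a 1 (nprod b n c) = nprod (nprod a 1 b) n c + nprod b n (nprod a 1 c)"
proof -
  have "Sum_any (\<lambda>i::nat. (of_int 1 gchoose i) *s nprod (nprod a (0 + int i) b) (1 + n - int i) c)
      = (\<Sum>i<2. (of_int 1 gchoose i) *s nprod (nprod a (0 + int i) b) (1 + n - int i) c)"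
  proof (rule Sum_any_eq_sum_lessThan)
    fix i :: nat
    assume "i \<ge> 2"
    moreover have "(1 gchoose i :: 'k) = of_nat (1 choose i)"
      by (metis binomial_gbinomial of_nat_1)
    ultimately show "(of_int 1 gchoose i) *s nprod (nprod a (0 + int i) b) (1 + n - int i) c = 0"
      by simp
  qed
  moreover have "Sum_any (\<lambda>i::nat. ((-1) ^ i * (of_int 0 gchoose i)) *s
           (nprod a (1 + 0 - int i) (nprod b (n + int i) c)
            - ((-1) powi 0) *s nprod b (n + 0 - int i) (nprod a (1 + int i) c)))
      = nprod a 1 (nprod b n c) - nprod b n (nprod a 1 c)"
    by (subst Sum_any_eq_sum_lessThan[where N = 1])
       (auto simp: gr0_conv_Suc Suc_le_eq)
  ultimately show ?thesis
    using borcherds[of 1 a 0 b n c] assms by (simp add: numeral_2_eq_2 algebra_simps)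
qed

end

text \<open>A locally nilpotent linear operator that is a derivation of every product and kills the
  vacuum.\<close>

locale nilpotent_derivation = vertex_algebra scale nprod vac
  for scale :: "'k::field_char_0 \<Rightarrow> 'v::ab_group_add \<Rightarrow> 'v" (infixr \<open>*s\<close> 75)
    and nprod :: "'v \<Rightarrow> int \<Rightarrow> 'v \<Rightarrow> 'v"
    and vac :: 'v +
  fixes D :: "'v \<Rightarrow> 'v"
  assumes D_add: "D (u + v) = D u + D v"
    and D_scale: "D (r *s v) = r *s D v"
    and D_nprod: "D (nprod b n c) = nprod (D b) n c + nprod b n (D c)"
    and D_vac: "D vac = 0"
    and D_nilpotent: "\<exists>N. (D ^^ N) v = 0"
begin

lemma D_0: "D 0 = 0"
  using D_scale[of 0 0] by simp

lemma D_sum: "D (\<Sum>i\<in>I. g i) = (\<Sum>i\<in>I. D (g i))"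
  by (induction I rule: infinite_finite_induct) (auto simp: D_add D_0)

lemma D_pow_0: "(D ^^ k) 0 = 0"
  by (induction k) (auto simp: D_0)

lemma D_pow_eq_0_mono: "(D ^^ N) v = 0 \<Longrightarrow> k \<ge> N \<Longrightarrow> (D ^^ k) v = 0"
  by (metis D_pow_0 funpow_add le_add_diff_inverse2 o_apply)

lemma D_pow_add: "(D ^^ k) (u + v) = (D ^^ k) u + (D ^^ k) v"
  by (induction k) (auto simp: D_add)

lemma D_pow_scale: "(D ^^ k) (r *s v) = r *s (D ^^ k) v"
  by (induction k) (auto simp: D_scale)

lemma exp_op_eq_sum:
  assumes "(D ^^ N) v = 0"
  shows "exp_op scale D v = (\<Sum>k<N. (1 / fact k) *s (D ^^ k) v)"
  unfolding exp_op_def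
  by (rule Sum_any_eq_sum_lessThan) (use D_pow_eq_0_mono[OF assms] in auto)

lemma linear_exp_op: "Vector_Spaces.linear scale scale (exp_op scale D)"
proof -
  have "exp_op scale D (u + v) = exp_op scale D u + exp_op scale D v" for u v
  proof -
    obtain M N where "(D ^^ M) u = 0" "(D ^^ N) v = 0"
      using D_nilpotent by metis
    then have "(D ^^ max M N) u = 0" "(D ^^ max M N) v = 0"
      by (auto elim: D_pow_eq_0_mono)
    moreover from this have "(D ^^ max M N) (u + v) = 0"
      by (simp add: D_pow_add)
    ultimately show ?thesis
      by (simp add: exp_op_eq_sum[of "max M N"] D_pow_add scale_right_distrib sum.distrib)
  qed
  moreover have "exp_op scale D (r *s v) = r *s exp_op scale D v" for r v
  proof -
    obtain N where "(D ^^ N) v = 0"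
      using D_nilpotent by metis
    moreover from this have "(D ^^ N) (r *s v) = 0"
      by (simp add: D_pow_scale)
    ultimately show ?thesis
      by (simp add: exp_op_eq_sum[of N] D_pow_scale scale_sum_right mult.commute)
  qed
  ultimately show ?thesis
    by (simp add: Vector_Spaces.linear_iff vector_space_axioms)
qed

text \<open>The Leibniz rule, divided by \<open>k!\<close> so that no binomial coefficients appear.\<close>

lemma D_pow_nprod:
  "(1 / fact k) *s (D ^^ k) (nprod b n c) =
    (\<Sum>i\<le>k. nprod ((1 / fact i) *s (D ^^ i) b) n ((1 / fact (k - i)) *s (D ^^ (k - i)) c))"
proof -
  define P where "P i j = nprod ((D ^^ i) b) n ((D ^^ j) c)" for i j
  have "(D ^^ k) (nprod b n c) = (\<Sum>i\<le>k. of_nat (k choose i) *s P i (k - i))"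
  proof (induction k)
    case 0
    show ?case
      by (simp add: P_def)
  next
    case (Suc k)
    have "(D ^^ Suc k) (nprod b n c) =
        (\<Sum>i\<le>k. of_nat (k choose i) *s P (Suc i) (k - i))
        + (\<Sum>i\<le>k. of_nat (k choose i) *s P i (Suc (k - i)))"
      by (simp add: Suc D_sum D_scale P_def D_nprod scale_right_distrib sum.distrib)
    also have "(\<Sum>i\<le>k. of_nat (k choose i) *s P i (Suc (k - i)))
        = (\<Sum>i\<le>Suc k. of_nat (k choose i) *s P i (Suc k - i))"
      by (simp add: Suc_diff_le)
    also have "\<dots> = P 0 (Suc k) + (\<Sum>i\<le>k. of_nat (k choose Suc i) *s P (Suc i) (k - i))"
      by (subst sum.atMost_Suc_shift) simp
    finally show ?case
      by (subst sum.atMost_Suc_shift)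
         (simp add: scale_left_distrib sum.distrib algebra_simps)
  qed
  then have "(1 / fact k) *s (D ^^ k) (nprod b n c) =
      (\<Sum>i\<le>k. (1 / fact k * of_nat (k choose i)) *s P i (k - i))"
    by (simp add: scale_sum_right)
  also have "\<dots> = (\<Sum>i\<le>k. (1 / fact i * (1 / fact (k - i))) *s P i (k - i))"
    by (rule sum.cong) (auto simp: binomial_fact)
  finally show ?thesis
    by (simp add: P_def nprod_scale_left nprod_scale_right mult.commute)
qed

lemma exp_op_nprod:
  "exp_op scale D (nprod b n c) = nprod (exp_op scale D b) n (exp_op scale D c)"
proof -
  obtain M1 M2 where M: "(D ^^ M1) b = 0" "(D ^^ M2) c = 0"
    using D_nilpotent by metis
  \<comment> \<open>Whenever \<open>i + j \<ge> N\<close>, one of \<open>D\<^sup>i b\<close> and \<open>D\<^sup>j c\<close> is zero, so the triangular Cauchy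
    sum equals the product of the two exponentials.\<close>
  define N where "N = M1 + M2"
  have N: "(D ^^ N) b = 0" "(D ^^ N) c = 0"
    using M by (auto simp: N_def elim: D_pow_eq_0_mono)
  define g where "g i j = nprod ((1 / fact i) *s (D ^^ i) b) n ((1 / fact j) *s (D ^^ j) c)"
    for i j
  have g_0: "g i j = 0" if "i + j \<ge> N" for i j
  proof -
    from that consider "i \<ge> M1" | "j \<ge> M2"
      unfolding N_def by linarith
    then show ?thesis
      by cases (simp_all add: g_def D_pow_eq_0_mono[OF M(1)] D_pow_eq_0_mono[OF M(2)])
  qed
  have Leibniz: "(1 / fact k) *s (D ^^ k) (nprod b n c) = (\<Sum>i\<le>k. g i (k - i))" for k
    unfolding g_def by (rule D_pow_nprod)
  then have "(1 / fact N) *s (D ^^ N) (nprod b n c) = 0"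
    using g_0 by simp
  then have "(D ^^ N) (nprod b n c) = 0"
    by simp
  then have "exp_op scale D (nprod b n c) = (\<Sum>k<N. \<Sum>i\<le>k. g i (k - i))"
    by (simp add: exp_op_eq_sum Leibniz del: scale_eq_0_iff)
  also have "\<dots> = (\<Sum>i<N. \<Sum>j<N. g i j)"
    by (rule sum_triangle_eq_square) (rule g_0)
  also have "\<dots> = nprod (exp_op scale D b) n (exp_op scale D c)"
    unfolding exp_op_eq_sum[OF N(1)] exp_op_eq_sum[OF N(2)] g_def
    by (simp only: nprod_sum_left) (simp only: nprod_sum_right)
  finally show ?thesis .
qed

lemma exp_op_vac: "exp_op scale D vac = vac"
  using exp_op_eq_sum[of 1 vac] D_vac by simp

end

section \<open>The degree filtration\<close>

context cft_type_voa
begin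

text \<open>The increasing filtration by degree: the sum of all \<open>G k\<close> with \<open>k \<le> n\<close>.\<close>

definition F :: "int \<Rightarrow> 'v set" where
  "F n = span (\<Union>k\<in>{..n}. G k)"

lemma F_closed:
  "0 \<in> F n" "u \<in> F n \<Longrightarrow> v \<in> F n \<Longrightarrow> u + v \<in> F n" "u \<in> F n \<Longrightarrow> v \<in> F n \<Longrightarrow> u - v \<in> F n"
  "u \<in> F n \<Longrightarrow> r *s u \<in> F n" "u \<in> F n \<Longrightarrow> - u \<in> F n"
  unfolding F_def by (auto intro: span_add span_diff span_scale span_zero span_neg)

lemma G_closed:
  "0 \<in> G n" "u \<in> G n \<Longrightarrow> v \<in> G n \<Longrightarrow> u + v \<in> G n" "u \<in> G n \<Longrightarrow> v \<in> G n \<Longrightarrow> u - v \<in> G n"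
  "u \<in> G n \<Longrightarrow> r *s u \<in> G n" "u \<in> G n \<Longrightarrow> - u \<in> G n"
  using subspace_G[of n] by (auto intro: subspace_add subspace_diff subspace_scale subspace_0
      subspace_neg)

lemma G_subset_F: "k \<le> n \<Longrightarrow> v \<in> G k \<Longrightarrow> v \<in> F n"
  unfolding F_def by (rule span_base) auto

lemma F_mono: "v \<in> F m \<Longrightarrow> m \<le> n \<Longrightarrow> v \<in> F n"
  unfolding F_def by (meson UN_mono atMost_subset_iff order_refl span_mono subsetD)

lemma F_neg: "n < 0 \<Longrightarrow> F n = {0}"
proof -
  assume "n < 0"
  then have "(\<Union>k\<in>{..n}. G k) = {0}"
    using nonneg_degree by force
  then show ?thesis
    by (simp add: F_def)
qed

lemma F_induct [consumes 1, case_names base add scale]: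
  assumes "v \<in> F n" "\<And>k v. k \<le> n \<Longrightarrow> v \<in> G k \<Longrightarrow> P v" "\<And>u v. P u \<Longrightarrow> P v \<Longrightarrow> P (u + v)"
    "\<And>r v. P v \<Longrightarrow> P (r *s v)"
  shows "P v"
proof -
  have P_0: "P 0"
    using assms(2)[of n 0] G_closed by auto
  from assms(1) have "v \<in> span (\<Union>k\<in>{..n}. G k)"
    by (simp add: F_def)
  then show ?thesis
    by (induction rule: span_induct_alt) (use P_0 assms(2-4) in auto)
qed

lemma F_split:
  assumes "w \<in> F n"
  obtains x u where "x \<in> G n" "u \<in> F (n - 1)" "w = x + u"
proof -
  from assms have "\<exists>x\<in>G n. \<exists>u\<in>F (n - 1). w = x + u"
  proof (induction rule: F_induct)
    case (base k v)
    show ?case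
    proof (cases "k = n")
      case True
      then show ?thesis
        using base F_closed(1)[of "n - 1"] by (intro bexI[of _ v] bexI[of _ 0]) auto
    next
      case False
      then show ?thesis
        using base G_closed(1)[of n] G_subset_F[of k "n - 1" v]
        by (intro bexI[of _ 0] bexI[of _ v]) auto
    qed
  next
    case (add v w)
    then obtain x u y z where "x \<in> G n" "u \<in> F (n - 1)" "v = x + u"
      "y \<in> G n" "z \<in> F (n - 1)" "w = y + z" by metis
    then have "x + y \<in> G n" "u + z \<in> F (n - 1)" "v + w = (x + y) + (u + z)"
      by (auto simp: G_closed F_closed)
    then show ?case by blast
  next
    case (scale r v)
    then show ?case
      by (metis F_closed(4) G_closed(4) scale_right_distrib)
  qed
  then show ?thesis
    using that by blast
qed

lemma F_0: "F 0 = G 0"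
proof
  show "F 0 \<subseteq> G 0"
  proof
    fix w
    assume "w \<in> F 0"
    then obtain x u where "x \<in> G 0" "u \<in> F (0 - 1)" "w = x + u"
      by (rule F_split)
    then show "w \<in> G 0"
      by (simp add: F_neg)
  qed
qed (auto intro: G_subset_F)

lemma F_0_vac: "v \<in> F 0 \<Longrightarrow> \<exists>c. v = c *s vac"
  using G_0 by (auto simp: F_0 span_singleton)

lemma ex_F: "\<exists>n\<ge>0. v \<in> F n"
proof -
  obtain f where f: "finite {n. f n \<noteq> 0}" "\<And>n. f n \<in> G n" "v = Sum_any f"
    using direct_sum[of v] by (auto simp: is_decomp_def)
  define N where "N = Max (insert 0 {n. f n \<noteq> 0})"
  have "f n \<in> F N" if "f n \<noteq> 0" for n
    using that f by (intro G_subset_F[of n]) (auto simp: N_def)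
  then have "v \<in> F N"
    unfolding f(3) Sum_any.expand_set F_def by (intro span_sum) (auto simp: F_def)
  moreover have "N \<ge> 0"
    using f(1) by (simp add: N_def)
  ultimately show ?thesis
    by blast
qed

lemma pr_eqI: "is_decomp G v f \<Longrightarrow> pr G n v = f n"
  unfolding pr_def using direct_sum[of v] by (simp add: the1_equality)

lemma pr_add: "pr G n (u + v) = pr G n u + pr G n v"
proof -
  obtain f g where "is_decomp G u f" "is_decomp G v g"
    using direct_sum by metis
  moreover have "is_decomp G (u + v) (\<lambda>n. f n + g n)"
  proof -
    have "{n. f n + g n \<noteq> 0} \<subseteq> {n. f n \<noteq> 0} \<union> {n. g n \<noteq> 0}"
      by auto
    then have "finite {n. f n + g n \<noteq> 0}"
      using calculation by (auto simp: is_decomp_def dest: finite_subset)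
    then show ?thesis
      using calculation by (auto simp: is_decomp_def Sum_any.distrib G_closed)
  qed
  ultimately show ?thesis
    by (simp add: pr_eqI)
qed

lemma pr_G:
  assumes "v \<in> G k"
  shows "pr G n v = (if n = k then v else 0)"
proof -
  have "Sum_any (\<lambda>n. if n = k then v else 0) = (\<Sum>n\<in>{k}. if n = k then v else 0)"
    by (rule Sum_any.expand_superset) auto
  then have "is_decomp G v (\<lambda>n. if n = k then v else 0)"
    using assms by (auto simp: is_decomp_def G_closed)
  then show ?thesis
    by (rule pr_eqI)
qed

lemma pr_scale: "pr G n (r *s v) = r *s pr G n v"
proof -
  obtain f where f: "is_decomp G v f"
    using direct_sum by metis
  have "Sum_any (\<lambda>n. r *s f n) = (\<Sum>n\<in>{n. f n \<noteq> 0}. r *s f n)"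
    by (rule Sum_any.expand_superset) (use f in \<open>auto simp: is_decomp_def\<close>)
  also have "\<dots> = r *s Sum_any f"
    by (simp add: Sum_any.expand_set scale_sum_right)
  finally have "is_decomp G (r *s v) (\<lambda>n. r *s f n)"
    using f finite_subset[of "{n. r *s f n \<noteq> 0}" "{n. f n \<noteq> 0}"]
    by (auto simp: is_decomp_def G_closed)
  then show ?thesis
    using f by (simp add: pr_eqI)
qed

lemma pr_F: "v \<in> F m \<Longrightarrow> m < n \<Longrightarrow> pr G n v = 0"
  by (induction rule: F_induct) (auto simp: pr_G pr_add pr_scale)

lemma pr_eq_iff:
  assumes "w \<in> F n" "v \<in> G n"
  shows "pr G n w = v \<longleftrightarrow> w - v \<in> F (n - 1)"
proof
  assume v: "pr G n w = v"
  obtain x u where "x \<in> G n" "u \<in> F (n - 1)" "w = x + u"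
    using assms(1) by (rule F_split)
  then show "w - v \<in> F (n - 1)"
    using v by (auto simp: pr_add pr_G pr_F)
next
  assume "w - v \<in> F (n - 1)"
  then have "pr G n (v + (w - v)) = v"
    using assms(2) by (simp only: pr_add) (simp add: pr_G pr_F)
  then show "pr G n w = v"
    by simp
qed

lemma G_Int_F_less: "v \<in> G n \<Longrightarrow> v \<in> F m \<Longrightarrow> m < n \<Longrightarrow> v = 0"
  using pr_F[of v m n] by (simp add: pr_G)

lemma nprod_1_F:
  assumes "a \<in> G 1" "v \<in> F n"
  shows "nprod a 1 v \<in> F (n - 1)"
  using assms(2)
proof (induction rule: F_induct)
  case (base k v)
  then show ?case
    using nprod_degree[OF assms(1) base(2), of 1] by (auto intro: G_subset_F[of "k - 1"])
qed (auto simp: nprod_add_right nprod_scale_right F_closed)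

lemma L0_F: "v \<in> F n \<Longrightarrow> nprod \<omega> 1 v \<in> F n"
  by (induction rule: F_induct)
     (auto simp: nprod_add_right nprod_scale_right F_closed L0_degree G_subset_F)

section \<open>Rigidity of unipotent endomorphisms\<close>

text \<open>The endomorphisms of the vertex algebra that induce the identity on the associated graded
  space of the filtration. They need not be assumed bijective.\<close>

definition unip_end :: "('v \<Rightarrow> 'v) set" where
  "unip_end = {f. Vector_Spaces.linear scale scale f \<and>
     (\<forall>a n b. f (nprod a n b) = nprod (f a) n (f b)) \<and> f vac = vac \<and>
     (\<forall>n. \<forall>v\<in>G n. f v - v \<in> F (n - 1))}"

lemma unip_endD:
  assumes "f \<in> unip_end"
  shows "f (u + v) = f u + f v" "f (r *s v) = r *s f v" "f (nprod a n b) = nprod (f a) n (f b)"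
    "f vac = vac" "v \<in> G n \<Longrightarrow> f v - v \<in> F (n - 1)"
  using assms by (auto simp: unip_end_def Vector_Spaces.linear_iff)

lemma unip_end_F:
  assumes "f \<in> unip_end" "v \<in> F n"
  shows "f v - v \<in> F (n - 1)"
  using assms(2)
proof (induction rule: F_induct)
  case (base k v)
  then show ?case
    using F_mono[OF unip_endD(5)[OF assms(1) base(2)], of "n - 1"] by simp
next
  case (add u v)
  then show ?case
    using F_closed(2)[OF add] by (simp add: unip_endD[OF assms(1)] algebra_simps)
next
  case (scale r v)
  then show ?case
    using F_closed(4)[OF scale, of r] by (simp add: unip_endD[OF assms(1)] scale_right_diff_distrib)
qed

lemma va_aut_minus_eq: "va_aut_minus scale nprod vac G = {f \<in> unip_end. bij f}"
proof -
  have "(f ` G n \<subseteq> F n \<and> (\<forall>v\<in>G n. pr G n (f v) = v)) \<longleftrightarrow> (\<forall>v\<in>G n. f v - v \<in> F (n - 1))"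
    for f :: "'v \<Rightarrow> 'v" and n
  proof -
    have "f v \<in> F n" if "f v - v \<in> F (n - 1)" "v \<in> G n" for v
      using F_closed(2)[OF F_mono[OF that(1), of n] G_subset_F[OF order_refl that(2)]] by simp
    then show ?thesis
      using pr_eq_iff by blast
  qed
  then show ?thesis
    by (auto simp: va_aut_minus_def va_aut_def unip_end_def F_def[symmetric])
qed

lemma unip_end_id: "id \<in> unip_end"
  by (auto simp: unip_end_def Vector_Spaces.linear_iff vector_space_axioms F_closed)

lemma unip_end_comp:
  assumes f: "f \<in> unip_end" and g: "g \<in> unip_end"
  shows "f \<circ> g \<in> unip_end"
proof -
  have "f (g v) - v \<in> F (n - 1)" if "v \<in> G n" for n v
  proof -
    have gv: "g v - v \<in> F (n - 1)"
      using unip_endD(5)[OF g that] .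
    then have "g v \<in> F n"
      using F_closed(2)[OF F_mono[OF gv, of n] G_subset_F[OF order_refl that]] by simp
    from F_closed(2)[OF unip_end_F[OF f this] gv] show ?thesis
      by simp
  qed
  then show ?thesis
    using f g by (auto simp: unip_end_def Vector_Spaces.linear_iff)
qed

lemma unip_end_omega:
  assumes "f \<in> unip_end"
  obtains a where "a \<in> G 1" "f \<omega> - \<omega> - a \<in> F 0"
proof -
  from F_split[of "f \<omega> - \<omega>" 1] unip_endD(5)[OF assms omega_degree] obtain a u
    where "a \<in> G 1" "u \<in> F 0" "f \<omega> - \<omega> = a + u"
    by auto
  then show ?thesis
    using that by auto
qed

text \<open>Every product \<open>(f \<omega>)(n)\<close> with \<open>n \<noteq> -1\<close> only depends on \<open>f \<omega>\<close> modulo the vacuum.\<close>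

lemma nprod_f_omega:
  assumes "f \<omega> - \<omega> - a \<in> F 0" "n \<noteq> -1"
  shows "nprod (f \<omega>) n v = nprod \<omega> n v + nprod a n v"
proof -
  obtain c where "f \<omega> - \<omega> - a = c *s vac"
    using F_0_vac assms(1) by blast
  then have "f \<omega> = \<omega> + a + c *s vac"
    by (simp add: algebra_simps)
  then show ?thesis
    using assms(2) by (simp add: nprod_add_left nprod_scale_left vacuum_left)
qed

lemma L0_perturbed:
  assumes "f \<in> unip_end" "f \<omega> - \<omega> - a \<in> F 0" "v \<in> G n"
  shows "nprod \<omega> 1 (f v) + nprod a 1 (f v) = of_int n *s f v"
  using unip_endD(3)[OF assms(1), of \<omega> 1 v] L0_degree[OF assms(3)]
  by (simp add: nprod_f_omega[of f, OF assms(2)] unip_endD(2)[OF assms(1)])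

lemma L0_perturbed_kernel:
  assumes "a \<in> G 1" and eq: "nprod \<omega> 1 u + nprod a 1 u = of_int n *s u" and "u \<in> F (n - 1)"
  shows "u = 0"
proof -
  have "u \<in> F (n - 1 - int j)" for j
  proof (induction j)
    case 0
    show ?case
      using assms(3) by simp
  next
    case (Suc j)
    define m where "m = n - 1 - int j"
    obtain x y where x: "x \<in> G m" and y: "y \<in> F (m - 1)" and u: "u = x + y"
      using Suc.IH unfolding m_def by (rule F_split)
    have "nprod \<omega> 1 u = of_int m *s x + nprod \<omega> 1 y"
      using x by (simp add: u nprod_add_right L0_degree)
    then have "of_int (n - m) *s x = nprod \<omega> 1 y + nprod a 1 u - of_int n *s y"
      using eq by (simp add: u scale_right_distrib scale_left_diff_distrib algebra_simps)
    moreover have "nprod a 1 u \<in> F (m - 1)"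
      using nprod_1_F[OF assms(1) Suc.IH] by (simp add: m_def)
    ultimately have "of_int (n - m) *s x \<in> F (m - 1)"
      using y by (simp add: F_closed L0_F)
    then have "(1 / of_int (n - m)) *s of_int (n - m) *s x \<in> F (m - 1)"
      by (rule F_closed)
    \<comment> \<open>Division is possible since \<open>m < n\<close> and the field has characteristic zero.\<close>
    moreover have "(of_int (n - m) :: 'k) \<noteq> 0"
      by (subst of_int_eq_0_iff) (simp add: m_def)
    ultimately have "x \<in> F (m - 1)"
      by (simp del: of_int_diff)
    then have "u \<in> F (m - 1)"
      using y u by (simp add: F_closed)
    then show ?case
      by (simp add: m_def algebra_simps)
  qed
  from this[of "nat n"] show ?thesis
    using F_neg[of "n - 1 - int (nat n)"] by auto
qed

lemma unip_end_eqI: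
  assumes f: "f \<in> unip_end" and g: "g \<in> unip_end" and fg: "f \<omega> - g \<omega> \<in> F 0"
  shows "f = g"
proof
  fix w
  obtain a where a: "a \<in> G 1" "g \<omega> - \<omega> - a \<in> F 0"
    using g by (rule unip_end_omega)
  have fa: "f \<omega> - \<omega> - a \<in> F 0"
    using F_closed(2)[OF fg a(2)] by (simp add: algebra_simps)
  obtain n where "w \<in> F n"
    using ex_F by blast
  then show "f w = g w"
  proof (induction rule: F_induct)
    case (base k v)
    have "f v - g v \<in> F (k - 1)"
      using F_closed(3)[OF unip_endD(5)[OF f base(2)] unip_endD(5)[OF g base(2)]] by simp
    moreover have "nprod \<omega> 1 (f v - g v) + nprod a 1 (f v - g v) = of_int k *s (f v - g v)"
      using L0_perturbed[OF f fa base(2)] L0_perturbed[OF g a(2) base(2)]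
      by (simp add: nprod_diff_right scale_right_diff_distrib algebra_simps)
    ultimately have "f v - g v = 0"
      using L0_perturbed_kernel[OF a(1)] by blast
    then show ?case
      by simp
  qed (auto simp: unip_endD[OF f] unip_endD[OF g])
qed

section \<open>The exponential map\<close>

lemma J1D: "a \<in> J1 nprod G \<Longrightarrow> a \<in> G 1" "a \<in> J1 nprod G \<Longrightarrow> nprod a 0 v = 0"
  by (auto simp: J1_def)

lemma J1_closed:
  "0 \<in> J1 nprod G" "a \<in> J1 nprod G \<Longrightarrow> b \<in> J1 nprod G \<Longrightarrow> a + b \<in> J1 nprod G"
  "a \<in> J1 nprod G \<Longrightarrow> - a \<in> J1 nprod G"
  using nprod_scale_left[of "-1" a 0] by (auto simp: J1_def G_closed nprod_add_left)

text \<open>The Borcherds identity for \<open>a, \<omega>, vac\<close> with \<open>p = -1\<close>, \<open>q = 0\<close>, \<open>r = 1\<close>: on the left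
  \<open>a(1) \<omega>\<close> is the only nonzero term, and on the right \<open>\<omega>(1) a = L(0) a\<close> is.\<close>

lemma nprod_1_omega:
  assumes a: "a \<in> J1 nprod G"
  shows "nprod a 1 \<omega> = a"
proof -
  have deg: "nprod a k \<omega> \<in> G (2 - k)" for k
    using nprod_degree[OF J1D(1)[OF a] omega_degree, of k] by (simp add: algebra_simps)
  have "(of_int (-1) gchoose i) *s nprod (nprod a (1 + int i) \<omega>) (-1 + 0 - int i) vac = 0"
    if i: "i \<ge> 1" for i
  proof (cases "i = 1")
    case True
    \<comment> \<open>\<open>a(2) \<omega>\<close> is a multiple of the vacuum, whose product of index \<open>-2\<close> is zero.\<close>
    have "nprod a 2 \<omega> \<in> F 0"
      using deg[of 2] by (simp add: F_0)
    then obtain c where "nprod a 2 \<omega> = c *s vac"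
      using F_0_vac by blast
    then show ?thesis
      using True by (simp add: nprod_scale_left vacuum_left)
  next
    case False
    then have "nprod a (1 + int i) \<omega> = 0"
      using deg[of "1 + int i"] nonneg_degree[of "2 - (1 + int i)"] i by auto
    then show ?thesis
      by simp
  qed
  then have lhs: "Sum_any (\<lambda>i::nat. (of_int (-1) gchoose i) *s
      nprod (nprod a (1 + int i) \<omega>) (-1 + 0 - int i) vac) = nprod a 1 \<omega>"
    by (subst Sum_any_eq_sum_lessThan[where N = 1]) (auto simp: creation)
  have "Sum_any (\<lambda>i::nat. ((-1) ^ i * (of_int 1 gchoose i)) *s
           (nprod a (-1 + 1 - int i) (nprod \<omega> (0 + int i) vac)
            - ((-1) powi 1) *s nprod \<omega> (0 + 1 - int i) (nprod a (-1 + int i) vac)))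
      = nprod \<omega> 1 a"
  proof (subst Sum_any_eq_sum_lessThan[where N = 1])
    fix i :: nat
    assume "i \<ge> 1"
    then show "((-1) ^ i * (of_int 1 gchoose i)) *s
           (nprod a (-1 + 1 - int i) (nprod \<omega> (0 + int i) vac)
            - ((-1) powi 1) *s nprod \<omega> (0 + 1 - int i) (nprod a (-1 + int i) vac)) = 0"
      by (simp add: vacuum_right)
  qed (simp add: vacuum_right creation)
  with lhs borcherds[of "-1" a 1 \<omega> 0 vac] have "nprod a 1 \<omega> = nprod \<omega> 1 a"
    by simp
  then show ?thesis
    using L0_degree[OF J1D(1)[OF a]] by simp
qed

lemma nprod_1_pow_F: "a \<in> G 1 \<Longrightarrow> v \<in> F n \<Longrightarrow> (nprod a 1 ^^ k) v \<in> F (n - int k)"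
proof (induction k)
  case (Suc k)
  then show ?case
    using nprod_1_F[of a "(nprod a 1 ^^ k) v" "n - int k"] by (simp add: algebra_simps)
qed simp

lemma nilpotent_derivation_nprod_1:
  assumes a: "a \<in> J1 nprod G"
  shows "nilpotent_derivation scale nprod vac (nprod a 1)"
proof unfold_locales
  show "nprod a 1 (nprod b n c) = nprod (nprod a 1 b) n c + nprod b n (nprod a 1 c)" for b n c
    by (rule nprod_1_derivation) (rule J1D[OF a])
  show "\<exists>N. (nprod a 1 ^^ N) v = 0" for v
  proof -
    obtain n where "n \<ge> 0" "v \<in> F n"
      using ex_F by blast
    then have "(nprod a 1 ^^ Suc (nat n)) v \<in> F (-1)"
      using nprod_1_pow_F[OF J1D(1)[OF a], of v n "Suc (nat n)"] by simp
    then show ?thesis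
      using F_neg[of "-1"] by (intro exI[of _ "Suc (nat n)"]) simp
  qed
qed (auto simp: nprod_add_right nprod_scale_right vacuum_right)

lemma exp_op_expand:
  assumes a: "a \<in> J1 nprod G" and v: "v \<in> F n"
  shows "exp_op scale (nprod a 1) v - v - nprod a 1 v \<in> F (n - 2)"
proof -
  interpret nilpotent_derivation scale nprod vac "nprod a 1"
    using a by (rule nilpotent_derivation_nprod_1)
  obtain N where "(nprod a 1 ^^ N) v = 0"
    using D_nilpotent by blast
  then have "(nprod a 1 ^^ (N + 2)) v = 0"
    by (rule D_pow_eq_0_mono) simp
  then have "exp_op scale (nprod a 1) v = (\<Sum>k<N + 2. (1 / fact k) *s (nprod a 1 ^^ k) v)"
    by (rule exp_op_eq_sum)
  also have "\<dots> = v + (nprod a 1 v + (\<Sum>k<N. (1 / fact (k + 2)) *s (nprod a 1 ^^ (k + 2)) v))"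
    by (simp add: sum.lessThan_Suc_shift numeral_2_eq_2
        del: sum.lessThan_Suc funpow.simps(2) fact_Suc)
       (simp add: fact_Suc)
  finally have "exp_op scale (nprod a 1) v - v - nprod a 1 v
      = (\<Sum>k<N. (1 / fact (k + 2)) *s (nprod a 1 ^^ (k + 2)) v)"
    by simp
  moreover have "(nprod a 1 ^^ (k + 2)) v \<in> F (n - 2)" for k
    using nprod_1_pow_F[OF J1D(1)[OF a] v, of "k + 2"] by (rule F_mono) simp
  ultimately show ?thesis
    unfolding F_def by (auto intro!: span_sum span_scale simp del: funpow.simps(2) fact_Suc)
qed

lemma exp_op_unip_end:
  assumes a: "a \<in> J1 nprod G"
  shows "exp_op scale (nprod a 1) \<in> unip_end"
proof -
  interpret nilpotent_derivation scale nprod vac "nprod a 1"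
    using a by (rule nilpotent_derivation_nprod_1)
  have "exp_op scale (nprod a 1) v - v \<in> F (n - 1)" if "v \<in> G n" for n v
  proof -
    have v: "v \<in> F n"
      using that by (rule G_subset_F[OF order_refl])
    have "exp_op scale (nprod a 1) v - v - nprod a 1 v \<in> F (n - 1)"
      using exp_op_expand[OF a v] by (rule F_mono) simp
    from F_closed(2)[OF this nprod_1_F[OF J1D(1)[OF a] v]] show ?thesis
      by simp
  qed
  then show ?thesis
    by (auto simp: unip_end_def linear_exp_op exp_op_nprod exp_op_vac)
qed

lemma exp_op_omega:
  assumes a: "a \<in> J1 nprod G"
  shows "exp_op scale (nprod a 1) \<omega> - \<omega> - a \<in> F 0"
  using exp_op_expand[OF a G_subset_F[OF order_refl omega_degree]] nprod_1_omega[OF a] by simp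

lemma exp_op_add:
  assumes a: "a \<in> J1 nprod G" and b: "b \<in> J1 nprod G"
  shows "exp_op scale (nprod (a + b) 1) = exp_op scale (nprod a 1) \<circ> exp_op scale (nprod b 1)"
    (is "?c = ?a \<circ> ?b")
proof (rule unip_end_eqI)
  note ua = exp_op_unip_end[OF a]
  show "?c \<in> unip_end"
    by (intro exp_op_unip_end J1_closed a b)
  show "?a \<circ> ?b \<in> unip_end"
    by (intro unip_end_comp exp_op_unip_end a b)
  have b1: "?b \<omega> - \<omega> \<in> F 1"
    using unip_endD(5)[OF exp_op_unip_end[OF b] omega_degree] by simp
  have "?a (?b \<omega> - \<omega>) - (?b \<omega> - \<omega>) \<in> F 0"
    using unip_end_F[OF ua b1] by simp
  moreover have "?a (?b \<omega>) = ?a (?b \<omega> - \<omega>) + ?a \<omega>"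
    using unip_endD(1)[OF ua, of "?b \<omega> - \<omega>" \<omega>] by simp
  ultimately have "?a (?b \<omega>) - ?a \<omega> - (?b \<omega> - \<omega>) \<in> F 0"
    by simp
  from F_closed(2)[OF F_closed(2)[OF this exp_op_omega[OF a]] exp_op_omega[OF b]]
  have "?a (?b \<omega>) - \<omega> - (a + b) \<in> F 0"
    by (simp add: algebra_simps)
  from F_closed(3)[OF exp_op_omega[OF J1_closed(2)[OF a b]] this]
  show "?c \<omega> - (?a \<circ> ?b) \<omega> \<in> F 0"
    by simp
qed

lemma exp_op_0: "exp_op scale (nprod 0 1) = id"
  using unip_end_eqI[OF exp_op_unip_end[OF J1_closed(1)] unip_end_id] exp_op_omega[OF J1_closed(1)]
  by simp

lemma bij_exp_op:
  assumes a: "a \<in> J1 nprod G"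
  shows "bij (exp_op scale (nprod a 1))"
proof (rule o_bij)
  show "exp_op scale (nprod (- a) 1) \<circ> exp_op scale (nprod a 1) = id"
    using exp_op_add[OF J1_closed(3)[OF a] a] by (simp add: exp_op_0)
  show "exp_op scale (nprod a 1) \<circ> exp_op scale (nprod (- a) 1) = id"
    using exp_op_add[OF a J1_closed(3)[OF a]] by (simp add: exp_op_0)
qed

lemma exp_op_inj:
  assumes a: "a \<in> J1 nprod G" and b: "b \<in> J1 nprod G"
    and eq: "exp_op scale (nprod a 1) = exp_op scale (nprod b 1)"
  shows "a = b"
proof -
  have "a - b \<in> F 0"
    using F_closed(3)[OF exp_op_omega[OF b] exp_op_omega[OF a]] eq by simp
  moreover have "a - b \<in> G 1"
    by (intro G_closed J1D a b)
  ultimately show ?thesis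
    using G_Int_F_less[of "a - b" 1 0] by simp
qed

lemma exp_op_surj:
  assumes f: "f \<in> unip_end" and "surj f"
  shows "\<exists>a\<in>J1 nprod G. f = exp_op scale (nprod a 1)"
proof -
  obtain a where a: "a \<in> G 1" "f \<omega> - \<omega> - a \<in> F 0"
    using f by (rule unip_end_omega)
  have "nprod a 0 w = 0" for w
  proof -
    obtain v where w: "w = f v"
      using \<open>surj f\<close> by blast
    \<comment> \<open>\<open>\<omega>(0) v = v(-2) vac\<close> only involves data preserved by \<open>f\<close>.\<close>
    have "nprod \<omega> 0 (f v) = f (nprod \<omega> 0 v)"
      by (simp add: L_minus_1 unip_endD(3,4)[OF f])
    also have "\<dots> = nprod \<omega> 0 (f v) + nprod a 0 (f v)"
      by (simp add: unip_endD(3)[OF f] nprod_f_omega[of f, OF a(2)])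
    finally show ?thesis
      by (simp add: w)
  qed
  with a(1) have J: "a \<in> J1 nprod G"
    by (auto simp: J1_def)
  have "f \<omega> - exp_op scale (nprod a 1) \<omega> \<in> F 0"
    using F_closed(3)[OF a(2) exp_op_omega[OF J]] by simp
  with f J show ?thesis
    by (blast intro: unip_end_eqI exp_op_unip_end)
qed

lemma group_J1_group: "group (J1_group nprod G)"
proof (rule groupI)
  show "\<exists>y\<in>carrier (J1_group nprod G). y \<otimes>\<^bsub>J1_group nprod G\<^esub> x = \<one>\<^bsub>J1_group nprod G\<^esub>"
    if "x \<in> carrier (J1_group nprod G)" for x
    using J1_closed(3)[of x] that by (intro bexI[of _ "- x"]) (simp_all add: J1_group_def)
qed (auto simp: J1_group_def J1_closed add.assoc)

lemma exp_op_iso: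
  "(\<lambda>a. exp_op scale (nprod a 1)) \<in> iso (J1_group nprod G) (va_aut_minus_group scale nprod vac G)"
proof -
  have "(\<lambda>a. exp_op scale (nprod a 1)) ` J1 nprod G = va_aut_minus scale nprod vac G"
    unfolding va_aut_minus_eq
  proof (intro equalityI subsetI)
    fix f
    assume "f \<in> (\<lambda>a. exp_op scale (nprod a 1)) ` J1 nprod G"
    then show "f \<in> {f \<in> unip_end. bij f}"
      using exp_op_unip_end bij_exp_op by blast
  next
    fix f
    assume "f \<in> {f \<in> unip_end. bij f}"
    then show "f \<in> (\<lambda>a. exp_op scale (nprod a 1)) ` J1 nprod G"
      using exp_op_surj[of f] by (auto simp: bij_is_surj)
  qed
  moreover have "inj_on (\<lambda>a. exp_op scale (nprod a 1)) (J1 nprod G)"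
    by (intro inj_onI exp_op_inj)
  ultimately have bij: "bij_betw (\<lambda>a. exp_op scale (nprod a 1)) (J1 nprod G)
      (va_aut_minus scale nprod vac G)"
    by (simp add: bij_betw_def)
  have "(\<lambda>a. exp_op scale (nprod a 1)) \<in> hom (J1_group nprod G) (va_aut_minus_group scale nprod vac G)"
  proof (rule homI)
    fix a
    assume "a \<in> carrier (J1_group nprod G)"
    then show "exp_op scale (nprod a 1) \<in> carrier (va_aut_minus_group scale nprod vac G)"
      using bij_betwE[OF bij] by (simp add: J1_group_def va_aut_minus_group_def)
  next
    fix a b
    assume "a \<in> carrier (J1_group nprod G)" "b \<in> carrier (J1_group nprod G)"
    then show "exp_op scale (nprod (a \<otimes>\<^bsub>J1_group nprod G\<^esub> b) 1) =
        exp_op scale (nprod a 1) \<otimes>\<^bsub>va_aut_minus_group scale nprod vac G\<^esub> exp_op scale (nprod b 1)"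
      using exp_op_add[of a b] by (simp add: J1_group_def va_aut_minus_group_def va_aut_group_def)
  qed
  then show ?thesis
    using bij by (simp add: iso_def J1_group_def va_aut_minus_group_def)
qed

text \<open>The group structure on \<open>Aut\<^sup>-\<close> is transported along the bijection.\<close>

lemma group_va_aut_minus_group: "group (va_aut_minus_group scale nprod vac G)"
proof -
  have "\<one>\<^bsub>J1_group nprod G\<^esub> = 0" "\<one>\<^bsub>va_aut_minus_group scale nprod vac G\<^esub> = id"
    by (simp_all add: J1_group_def va_aut_minus_group_def va_aut_group_def)
  then show ?thesis
    using group.iso_imp_img_group[OF group_J1_group exp_op_iso] exp_op_0
    by (simp add: va_aut_minus_group_def va_aut_group_def)
qed

end

theorem proposition4p1:
  fixes scale :: "'k::real_normed_field \<Rightarrow> 'v::ab_group_add \<Rightarrow> 'v"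
    and nprod :: "'v \<Rightarrow> int \<Rightarrow> 'v \<Rightarrow> 'v"
    and vac \<omega> :: 'v
    and G :: "int \<Rightarrow> 'v set"
  assumes "cft_type_voa scale nprod vac G \<omega>"
  shows "group (J1_group nprod G) \<and>
    group (va_aut_minus_group scale nprod vac G) \<and>
    (\<lambda>a. exp_op scale (nprod a 1)) \<in> iso (J1_group nprod G) (va_aut_minus_group scale nprod vac G)"
proof -
  interpret cft_type_voa scale nprod vac G \<omega>
    by (rule assms)
  show ?thesis
    by (intro conjI group_J1_group group_va_aut_minus_group exp_op_iso)
qed

end
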